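(* Let $R$ be a reduced commutative noetherian local ring and let $M$ be a finitely generated $R$-module. Then $$\operatorname{Ass}(R)\cap\Big(\bigcup_{i\ge 0}\operatorname{Ass}_R(\operatorname{Ext}^i_R(M,R))\Big)=\operatorname{Ass}(R)\cap\Big(\bigcup_{i\ge 0}\operatorname{Supp}(\operatorname{Ext}^i_R(M,R))\Big).$$ *)

theory Defs
  imports "HOL-Algebra.Module" "HOL-Algebra.Ring_Divisibility"
begin

section \<open>Rings and modules\<close>

text \<open>
  The record type of modules extends that of rings; the fields \<open>mult\<close> and \<open>one\<close>
  of a module play no role in the locale \<^locale>\<open>module\<close> and are filled arbitrarily below.
\<close>

definition reduced_ring :: "('a, 'b) ring_scheme \<Rightarrow> bool" where
  "reduced_ring R \<longleftrightarrow> cring R \<and>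
     (\<forall>x\<in>carrier R. \<forall>n::nat. x [^]\<^bsub>R\<^esub> n = \<zero>\<^bsub>R\<^esub> \<longrightarrow> x = \<zero>\<^bsub>R\<^esub>)"

definition local_ring :: "('a, 'b) ring_scheme \<Rightarrow> bool" where
  "local_ring R \<longleftrightarrow> cring R \<and> (\<exists>!I. maximalideal I R)"

definition self_module :: "('a, 'b) ring_scheme \<Rightarrow> ('a, 'a) module" where
  "self_module R = \<lparr>carrier = carrier R, monoid.mult = monoid.mult R, one = one R,
     ring.zero = ring.zero R, ring.add = ring.add R, smult = monoid.mult R\<rparr>"

definition fin_gen_module :: "('a, 'b) ring_scheme \<Rightarrow> ('a, 'm) module \<Rightarrow> bool" where
  "fin_gen_module R M \<longleftrightarrow> module R M \<and>
     (\<exists>A\<subseteq>carrier M. finite A \<and>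
        carrier M = {\<Oplus>\<^bsub>M\<^esub>x\<in>A. c x \<odot>\<^bsub>M\<^esub> x | c. c \<in> A \<rightarrow> carrier R})"

definition mod_hom :: "('a, 'b) ring_scheme \<Rightarrow> ('a, 'm) module \<Rightarrow> ('a, 'n) module \<Rightarrow> ('m \<Rightarrow> 'n) set"
  where "mod_hom R M N = {f \<in> carrier M \<rightarrow>\<^sub>E carrier N.
     (\<forall>x\<in>carrier M. \<forall>y\<in>carrier M. f (x \<oplus>\<^bsub>M\<^esub> y) = f x \<oplus>\<^bsub>N\<^esub> f y) \<and>
     (\<forall>a\<in>carrier R. \<forall>x\<in>carrier M. f (a \<odot>\<^bsub>M\<^esub> x) = a \<odot>\<^bsub>N\<^esub> f x)}"

definition Hom_module :: "('a, 'b) ring_scheme \<Rightarrow> ('a, 'm) module \<Rightarrow> ('a, 'n) module \<Rightarrow> ('a, 'm \<Rightarrow> 'n) module"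
  where "Hom_module R M N = \<lparr>carrier = mod_hom R M N, monoid.mult = undefined, one = undefined,
     ring.zero = (\<lambda>x\<in>carrier M. \<zero>\<^bsub>N\<^esub>),
     ring.add = (\<lambda>f g. \<lambda>x\<in>carrier M. f x \<oplus>\<^bsub>N\<^esub> g x),
     smult = (\<lambda>a f. \<lambda>x\<in>carrier M. a \<odot>\<^bsub>N\<^esub> f x)\<rparr>"

definition quotient_module :: "('a, 'm) module \<Rightarrow> 'm set \<Rightarrow> ('a, 'm set) module" where
  "quotient_module M H = \<lparr>carrier = a_rcosets\<^bsub>M\<^esub> H, monoid.mult = undefined, one = undefined,
     ring.zero = H, ring.add = set_add M, smult = (\<lambda>a X. \<Union>x\<in>X. H +>\<^bsub>M\<^esub> (a \<odot>\<^bsub>M\<^esub> x))\<rparr>"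


section \<open>Associated primes and support\<close>

definition annihilator :: "('a, 'b) ring_scheme \<Rightarrow> ('a, 'm) module \<Rightarrow> 'm \<Rightarrow> 'a set" where
  "annihilator R M x = {a \<in> carrier R. a \<odot>\<^bsub>M\<^esub> x = \<zero>\<^bsub>M\<^esub>}"

definition Ass :: "('a, 'b) ring_scheme \<Rightarrow> ('a, 'm) module \<Rightarrow> 'a set set" where
  "Ass R M = {P. primeideal P R \<and> (\<exists>x\<in>carrier M. P = annihilator R M x)}"

definition frac_rel :: "('a, 'b) ring_scheme \<Rightarrow> 'a set \<Rightarrow> ('a, 'm) module \<Rightarrow> (('m \<times> 'a) \<times> ('m \<times> 'a)) set"
  where "frac_rel R S M = {((m, s), (n, t)). m \<in> carrier M \<and> n \<in> carrier M \<and> s \<in> S \<and> t \<in> S \<and>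
     (\<exists>u\<in>S. u \<odot>\<^bsub>M\<^esub> (t \<odot>\<^bsub>M\<^esub> m) = u \<odot>\<^bsub>M\<^esub> (s \<odot>\<^bsub>M\<^esub> n))}"

text \<open>
  The localization of \<open>M\<close> at a multiplicative subset \<open>S\<close>: its elements are the fractions
  \<open>m/s\<close>, that is, the equivalence classes of pairs \<open>(m, s)\<close>.  Only the \<open>R\<close>-module structure is recorded.
\<close>

definition localization :: "('a, 'b) ring_scheme \<Rightarrow> 'a set \<Rightarrow> ('a, 'm) module \<Rightarrow> ('a, ('m \<times> 'a) set) module"
  where "localization R S M = \<lparr>carrier = (carrier M \<times> S) // frac_rel R S M,
     monoid.mult = undefined, one = undefined,
     ring.zero = frac_rel R S M `` {(\<zero>\<^bsub>M\<^esub>, \<one>\<^bsub>R\<^esub>)},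
     ring.add = (\<lambda>X Y. \<Union>(m, s)\<in>X. \<Union>(n, t)\<in>Y.
              frac_rel R S M `` {(t \<odot>\<^bsub>M\<^esub> m \<oplus>\<^bsub>M\<^esub> s \<odot>\<^bsub>M\<^esub> n, s \<otimes>\<^bsub>R\<^esub> t)}),
     smult = (\<lambda>a X. \<Union>(m, s)\<in>X. frac_rel R S M `` {(a \<odot>\<^bsub>M\<^esub> m, s)})\<rparr>"

definition Supp :: "('a, 'b) ring_scheme \<Rightarrow> ('a, 'm) module \<Rightarrow> 'a set set" where
  "Supp R M = {P. primeideal P R \<and>
     carrier (localization R (carrier R - P) M) \<noteq> {\<zero>\<^bsub>localization R (carrier R - P) M\<^esub>}}"


section \<open>The standard free resolution\<close>

text \<open>The free module with basis \<open>B\<close>: finitely supported functions from \<open>B\<close> to \<open>R\<close>.\<close>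

definition free_module :: "('a, 'b) ring_scheme \<Rightarrow> 'c set \<Rightarrow> ('a, 'c \<Rightarrow> 'a) module" where
  "free_module R B = \<lparr>carrier = {f. range f \<subseteq> carrier R \<and> finite {b. f b \<noteq> \<zero>\<^bsub>R\<^esub>} \<and> {b. f b \<noteq> \<zero>\<^bsub>R\<^esub>} \<subseteq> B},
     monoid.mult = undefined, one = undefined,
     ring.zero = (\<lambda>_. \<zero>\<^bsub>R\<^esub>), ring.add = (\<lambda>f g b. f b \<oplus>\<^bsub>R\<^esub> g b), smult = (\<lambda>a f b. a \<otimes>\<^bsub>R\<^esub> f b)\<rparr>"

text \<open>
  The linear map from a free module to \<open>N\<close> that sends each basis element \<open>b\<close> to \<open>g b\<close>.
\<close>

definition linear_ext :: "('a, 'b) ring_scheme \<Rightarrow> ('a, 'n) module \<Rightarrow> ('c \<Rightarrow> 'n) \<Rightarrow> ('c \<Rightarrow> 'a) \<Rightarrow> 'n" where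
  "linear_ext R N g f = (\<Oplus>\<^bsub>N\<^esub>b\<in>{b. f b \<noteq> \<zero>\<^bsub>R\<^esub>}. f b \<odot>\<^bsub>N\<^esub> g b)"

text \<open>
  All terms \<open>F\<^sub>n\<close> of the resolution have to live in one HOL type.  Their basis elements are therefore
  taken from the following datatype: \<open>F\<^sub>0\<close> is free on the elements of \<open>M\<close> (constructor \<open>Elt\<close>), and
  \<open>F\<^sub>n\<^sub>+\<^sub>1\<close> is free on the formal linear combinations of basis elements of \<open>F\<^sub>n\<close> (constructor \<open>Rel\<close>,
  applied to a list of coefficients and basis elements) whose value is killed by the map
  leaving \<open>F\<^sub>n\<close>.  A basis element \<open>Elt m\<close> is sent to \<open>m\<close>, and \<open>Rel w\<close> to the value of \<open>w\<close>.
\<close>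

datatype ('a, 'm) syzygy = Elt (elt: 'm) | Rel (rel: "('a \<times> ('a, 'm) syzygy) list")

primrec comb_value :: "('a, 'b) ring_scheme \<Rightarrow> ('a \<times> 'c) list \<Rightarrow> 'c \<Rightarrow> 'a" where
  "comb_value R [] = (\<lambda>_. \<zero>\<^bsub>R\<^esub>)"
| "comb_value R (p # w) = (comb_value R w)(snd p := fst p \<oplus>\<^bsub>R\<^esub> comb_value R w (snd p))"

fun std_basis :: "('a, 'b) ring_scheme \<Rightarrow> ('a, 'm) module \<Rightarrow> nat \<Rightarrow> ('a, 'm) syzygy set" where
  "std_basis R M 0 = Elt ` carrier M"
| "std_basis R M (Suc 0) = Rel ` {w \<in> lists (carrier R \<times> std_basis R M 0).
     linear_ext R M elt (comb_value R w) = \<zero>\<^bsub>M\<^esub>}"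
| "std_basis R M (Suc (Suc n)) = Rel ` {w \<in> lists (carrier R \<times> std_basis R M (Suc n)).
     linear_ext R (free_module R (std_basis R M n)) (comb_value R \<circ> rel) (comb_value R w)
       = \<zero>\<^bsub>free_module R (std_basis R M n)\<^esub>}"

definition std_res :: "('a, 'b) ring_scheme \<Rightarrow> ('a, 'm) module \<Rightarrow> nat \<Rightarrow> ('a, ('a, 'm) syzygy \<Rightarrow> 'a) module"
  where "std_res R M n = free_module R (std_basis R M n)"

text \<open>The augmentation \<open>F\<^sub>0 \<rightarrow> M\<close> and the differentials \<open>F\<^sub>n\<^sub>+\<^sub>1 \<rightarrow> F\<^sub>n\<close>:\<close>

definition std_aug :: "('a, 'b) ring_scheme \<Rightarrow> ('a, 'm) module \<Rightarrow> (('a, 'm) syzygy \<Rightarrow> 'a) \<Rightarrow> 'm" where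
  "std_aug R M = linear_ext R M elt"

definition std_diff :: "('a, 'b) ring_scheme \<Rightarrow> ('a, 'm) module \<Rightarrow> nat \<Rightarrow>
    (('a, 'm) syzygy \<Rightarrow> 'a) \<Rightarrow> (('a, 'm) syzygy \<Rightarrow> 'a)" where
  "std_diff R M n = linear_ext R (std_res R M n) (comb_value R \<circ> rel)"


section \<open>Ext\<close>

text \<open>
  The cohomology of the complex \<open>Hom(F\<^sub>0, N) \<rightarrow> Hom(F\<^sub>1, N) \<rightarrow> \<dots>\<close> at position \<open>i\<close>,
  where \<open>d n\<close> is the differential \<open>F\<^sub>n\<^sub>+\<^sub>1 \<rightarrow> F\<^sub>n\<close>.
\<close>

definition Hom_cocycles :: "('a, 'b) ring_scheme \<Rightarrow> (nat \<Rightarrow> ('a, 'f) module) \<Rightarrow> (nat \<Rightarrow> 'f \<Rightarrow> 'f) \<Rightarrow>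
    ('a, 'n) module \<Rightarrow> nat \<Rightarrow> ('f \<Rightarrow> 'n) set" where
  "Hom_cocycles R F d N i =
     {f \<in> mod_hom R (F i) N. \<forall>x\<in>carrier (F (Suc i)). f (d i x) = \<zero>\<^bsub>N\<^esub>}"

definition Hom_coboundaries :: "('a, 'b) ring_scheme \<Rightarrow> (nat \<Rightarrow> ('a, 'f) module) \<Rightarrow> (nat \<Rightarrow> 'f \<Rightarrow> 'f) \<Rightarrow>
    ('a, 'n) module \<Rightarrow> nat \<Rightarrow> ('f \<Rightarrow> 'n) set" where
  "Hom_coboundaries R F d N i = (case i of
       0 \<Rightarrow> {\<zero>\<^bsub>Hom_module R (F 0) N\<^esub>}
     | Suc j \<Rightarrow> (\<lambda>g. \<lambda>x\<in>carrier (F (Suc j)). g (d j x)) ` mod_hom R (F j) N)"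

definition Hom_cohomology :: "('a, 'b) ring_scheme \<Rightarrow> (nat \<Rightarrow> ('a, 'f) module) \<Rightarrow> (nat \<Rightarrow> 'f \<Rightarrow> 'f) \<Rightarrow>
    ('a, 'n) module \<Rightarrow> nat \<Rightarrow> ('a, ('f \<Rightarrow> 'n) set) module" where
  "Hom_cohomology R F d N i =
     quotient_module ((Hom_module R (F i) N)\<lparr>carrier := Hom_cocycles R F d N i\<rparr>)
       (Hom_coboundaries R F d N i)"

text \<open>
  \<open>Ext\<^sup>i(M, N)\<close> is computed from the standard free resolution of \<open>M\<close>, which is shown below to be
  a free resolution.  Another projective resolution gives an isomorphic module.
\<close>

definition Ext :: "('a, 'b) ring_scheme \<Rightarrow> nat \<Rightarrow> ('a, 'm) module \<Rightarrow> ('a, 'n) module \<Rightarrow>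
    ('a, ((('a, 'm) syzygy \<Rightarrow> 'a) \<Rightarrow> 'n) set) module" where
  "Ext R i M N = Hom_cohomology R (std_res R M) (std_diff R M) N i"


section \<open>The standard resolution is a free resolution, and Ext is a module\<close>

lemma free_module_simps:
  "carrier (free_module R B) = {f. range f \<subseteq> carrier R \<and> finite {b. f b \<noteq> \<zero>\<^bsub>R\<^esub>} \<and> {b. f b \<noteq> \<zero>\<^bsub>R\<^esub>} \<subseteq> B}"
  "\<zero>\<^bsub>free_module R B\<^esub> = (\<lambda>_. \<zero>\<^bsub>R\<^esub>)"
  "f \<oplus>\<^bsub>free_module R B\<^esub> g = (\<lambda>b. f b \<oplus>\<^bsub>R\<^esub> g b)"
  "a \<odot>\<^bsub>free_module R B\<^esub> f = (\<lambda>b. a \<otimes>\<^bsub>R\<^esub> f b)"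
  by (simp_all add: free_module_def)

lemma self_module_module:
  assumes "cring R" shows "Module.module R (self_module R)"
proof -
  interpret cring R by fact
  have "abelian_group (self_module R)"
    by (rule abelian_groupI) (auto simp: self_module_def a_ac intro: exI[of _ "\<ominus>\<^bsub>R\<^esub> x" for x] l_neg bexI[of _ "\<ominus>\<^bsub>R\<^esub> x" for x])
  then show ?thesis
    by (intro moduleI assms) (auto simp: self_module_def l_distr r_distr m_assoc)
qed

lemma free_module_module:
  assumes "cring R" shows "Module.module R (free_module R B)"
proof -
  interpret cring R by fact
  have cl: "finite {b. f b \<oplus>\<^bsub>R\<^esub> g b \<noteq> \<zero>\<^bsub>R\<^esub>}" "{b. f b \<oplus>\<^bsub>R\<^esub> g b \<noteq> \<zero>\<^bsub>R\<^esub>} \<subseteq> B"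
    if "f \<in> carrier (free_module R B)" "g \<in> carrier (free_module R B)" for f g
  proof -
    have "{b. f b \<oplus>\<^bsub>R\<^esub> g b \<noteq> \<zero>\<^bsub>R\<^esub>} \<subseteq> {b. f b \<noteq> \<zero>\<^bsub>R\<^esub>} \<union> {b. g b \<noteq> \<zero>\<^bsub>R\<^esub>}" by auto
    with that show "finite {b. f b \<oplus>\<^bsub>R\<^esub> g b \<noteq> \<zero>\<^bsub>R\<^esub>}" "{b. f b \<oplus>\<^bsub>R\<^esub> g b \<noteq> \<zero>\<^bsub>R\<^esub>} \<subseteq> B"
      unfolding free_module_simps by (auto intro: finite_subset)
  qed
  have cs: "finite {b. a \<otimes>\<^bsub>R\<^esub> f b \<noteq> \<zero>\<^bsub>R\<^esub>}" "{b. a \<otimes>\<^bsub>R\<^esub> f b \<noteq> \<zero>\<^bsub>R\<^esub>} \<subseteq> B"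
    if "f \<in> carrier (free_module R B)" "a \<in> carrier R" for f a
  proof -
    have "{b. a \<otimes>\<^bsub>R\<^esub> f b \<noteq> \<zero>\<^bsub>R\<^esub>} \<subseteq> {b. f b \<noteq> \<zero>\<^bsub>R\<^esub>}" using that by auto
    with that show "finite {b. a \<otimes>\<^bsub>R\<^esub> f b \<noteq> \<zero>\<^bsub>R\<^esub>}" "{b. a \<otimes>\<^bsub>R\<^esub> f b \<noteq> \<zero>\<^bsub>R\<^esub>} \<subseteq> B"
      unfolding free_module_simps by (auto intro: finite_subset)
  qed
  have "abelian_group (free_module R B)"
  proof (rule abelian_groupI)
    fix f g assume "f \<in> carrier (free_module R B)" "g \<in> carrier (free_module R B)"
    then show "f \<oplus>\<^bsub>free_module R B\<^esub> g \<in> carrier (free_module R B)"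
      using cl[of f g] by (simp add: free_module_simps image_subset_iff)
  next
    fix f assume f: "f \<in> carrier (free_module R B)"
    have "\<ominus>\<^bsub>R\<^esub> f b \<noteq> \<zero>\<^bsub>R\<^esub> \<longleftrightarrow> f b \<noteq> \<zero>\<^bsub>R\<^esub>" for b
      using f by (auto simp: free_module_simps image_subset_iff)
    with f show "\<exists>g\<in>carrier (free_module R B). g \<oplus>\<^bsub>free_module R B\<^esub> f = \<zero>\<^bsub>free_module R B\<^esub>"
      by (intro bexI[of _ "\<lambda>b. \<ominus>\<^bsub>R\<^esub> f b"]) (auto simp: free_module_simps image_subset_iff l_neg)
  qed (auto simp: free_module_simps image_subset_iff a_ac)
  then show ?thesis
  proof (intro moduleI assms)
    fix a f assume "a \<in> carrier R" "f \<in> carrier (free_module R B)"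
    then show "a \<odot>\<^bsub>free_module R B\<^esub> f \<in> carrier (free_module R B)"
      using cs[of f a] by (simp add: free_module_simps image_subset_iff)
  qed (auto simp: free_module_simps image_subset_iff l_distr r_distr m_assoc)
qed

lemma linear_ext_superset:
  assumes "Module.module R N" "f \<in> carrier (free_module R B)" "g \<in> B \<rightarrow> carrier N"
    "finite A" "{b. f b \<noteq> \<zero>\<^bsub>R\<^esub>} \<subseteq> A" "A \<subseteq> B"
  shows "linear_ext R N g f = (\<Oplus>\<^bsub>N\<^esub>b\<in>A. f b \<odot>\<^bsub>N\<^esub> g b)"
proof -
  interpret Module.module R N by fact
  show ?thesis unfolding linear_ext_def
    using assms
    by (intro M.add.finprod_mono_neutral_cong_left) (auto simp: free_module_simps Pi_iff image_subset_iff subset_iff)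
qed

lemma linear_ext_hom:
  assumes "Module.module R N" "g \<in> B \<rightarrow> carrier N"
  shows linear_ext_closed: "f \<in> carrier (free_module R B) \<Longrightarrow> linear_ext R N g f \<in> carrier N"
    and linear_ext_add: "f \<in> carrier (free_module R B) \<Longrightarrow> h \<in> carrier (free_module R B) \<Longrightarrow>
      linear_ext R N g (f \<oplus>\<^bsub>free_module R B\<^esub> h) = linear_ext R N g f \<oplus>\<^bsub>N\<^esub> linear_ext R N g h"
    and linear_ext_smult: "a \<in> carrier R \<Longrightarrow> f \<in> carrier (free_module R B) \<Longrightarrow>
      linear_ext R N g (a \<odot>\<^bsub>free_module R B\<^esub> f) = a \<odot>\<^bsub>N\<^esub> linear_ext R N g f"
proof -
  interpret Module.module R N by fact
  interpret F: Module.module R "free_module R B" by (rule free_module_module) (rule R.is_cring)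
  show "f \<in> carrier (free_module R B) \<Longrightarrow> linear_ext R N g f \<in> carrier N" for f
    unfolding linear_ext_def using assms(2)
    by (intro M.finsum_closed) (auto simp: free_module_simps image_subset_iff Pi_iff)
  show "linear_ext R N g (f \<oplus>\<^bsub>free_module R B\<^esub> h) = linear_ext R N g f \<oplus>\<^bsub>N\<^esub> linear_ext R N g h"
    if fh: "f \<in> carrier (free_module R B)" "h \<in> carrier (free_module R B)" for f h
  proof -
    let ?A = "{b. f b \<noteq> \<zero>\<^bsub>R\<^esub>} \<union> {b. h b \<noteq> \<zero>\<^bsub>R\<^esub>}"
    have A: "finite ?A" "?A \<subseteq> B" using fh by (auto simp: free_module_simps)
    have fh': "f \<oplus>\<^bsub>free_module R B\<^esub> h \<in> carrier (free_module R B)" using fh by simp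
    have supp: "{b. (f \<oplus>\<^bsub>free_module R B\<^esub> h) b \<noteq> \<zero>\<^bsub>R\<^esub>} \<subseteq> ?A" by (auto simp: free_module_simps)
    have "linear_ext R N g (f \<oplus>\<^bsub>free_module R B\<^esub> h) = (\<Oplus>\<^bsub>N\<^esub>b\<in>?A. (f b \<oplus>\<^bsub>R\<^esub> h b) \<odot>\<^bsub>N\<^esub> g b)"
      using linear_ext_superset[OF assms(1) fh' assms(2) A(1) supp A(2)]
      by (simp add: free_module_simps)
    also have "\<dots> = (\<Oplus>\<^bsub>N\<^esub>b\<in>?A. f b \<odot>\<^bsub>N\<^esub> g b \<oplus>\<^bsub>N\<^esub> h b \<odot>\<^bsub>N\<^esub> g b)"
      using fh A assms(2) by (intro M.finsum_cong' refl)
        (auto simp: free_module_simps image_subset_iff Pi_iff smult_l_distr subset_iff)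
    also have "\<dots> = (\<Oplus>\<^bsub>N\<^esub>b\<in>?A. f b \<odot>\<^bsub>N\<^esub> g b) \<oplus>\<^bsub>N\<^esub> (\<Oplus>\<^bsub>N\<^esub>b\<in>?A. h b \<odot>\<^bsub>N\<^esub> g b)"
      using fh A assms(2) by (intro M.finsum_addf)
        (auto simp: free_module_simps image_subset_iff Pi_iff subset_iff)
    also have "\<dots> = linear_ext R N g f \<oplus>\<^bsub>N\<^esub> linear_ext R N g h"
      using linear_ext_superset[OF assms(1) fh(1) assms(2) A(1) _ A(2)]
        linear_ext_superset[OF assms(1) fh(2) assms(2) A(1) _ A(2)] by auto
    finally show ?thesis .
  qed
  show "linear_ext R N g (a \<odot>\<^bsub>free_module R B\<^esub> f) = a \<odot>\<^bsub>N\<^esub> linear_ext R N g f"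
    if f: "a \<in> carrier R" "f \<in> carrier (free_module R B)" for a f
  proof -
    let ?A = "{b. f b \<noteq> \<zero>\<^bsub>R\<^esub>}"
    have A: "finite ?A" "?A \<subseteq> B" using f by (auto simp: free_module_simps)
    have f': "a \<odot>\<^bsub>free_module R B\<^esub> f \<in> carrier (free_module R B)" using f by simp
    have supp: "{b. (a \<odot>\<^bsub>free_module R B\<^esub> f) b \<noteq> \<zero>\<^bsub>R\<^esub>} \<subseteq> ?A" using f by (auto simp: free_module_simps)
    have "linear_ext R N g (a \<odot>\<^bsub>free_module R B\<^esub> f) = (\<Oplus>\<^bsub>N\<^esub>b\<in>?A. (a \<otimes>\<^bsub>R\<^esub> f b) \<odot>\<^bsub>N\<^esub> g b)"
      using linear_ext_superset[OF assms(1) f' assms(2) A(1) supp A(2)]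
      by (simp add: free_module_simps)
    also have "\<dots> = (\<Oplus>\<^bsub>N\<^esub>b\<in>?A. a \<odot>\<^bsub>N\<^esub> (f b \<odot>\<^bsub>N\<^esub> g b))"
      using f A assms(2) by (intro M.finsum_cong' refl)
        (auto simp: free_module_simps image_subset_iff Pi_iff smult_assoc1 subset_iff)
    also have "\<dots> = a \<odot>\<^bsub>N\<^esub> linear_ext R N g f"
      unfolding linear_ext_def using f A assms(2)
      by (intro finsum_smult_ldistr[symmetric])
        (auto simp: free_module_simps image_subset_iff Pi_iff subset_iff)
    finally show ?thesis .
  qed
qed

lemma comb_value_closed:
  assumes "cring R" "w \<in> lists (carrier R \<times> B)"
  shows "comb_value R w \<in> carrier (free_module R B)"
proof -
  interpret cring R by fact
  show ?thesis using assms(2)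
  proof (induction w)
    case Nil then show ?case by (auto simp: free_module_simps)
  next
    case (Cons p w)
    have "{b. comb_value R (p # w) b \<noteq> \<zero>\<^bsub>R\<^esub>} \<subseteq> insert (snd p) {b. comb_value R w b \<noteq> \<zero>\<^bsub>R\<^esub>}"
      by auto
    moreover have "finite (insert (snd p) {b. comb_value R w b \<noteq> \<zero>\<^bsub>R\<^esub>})"
      using Cons by (auto simp: free_module_simps)
    ultimately have "finite {b. comb_value R (p # w) b \<noteq> \<zero>\<^bsub>R\<^esub>}" by (rule finite_subset)
    then show ?case using Cons by (auto simp: free_module_simps image_subset_iff split: if_splits)
  qed
qed

lemma comb_value_surj:
  assumes "cring R" "f \<in> carrier (free_module R B)"
  shows "\<exists>w\<in>lists (carrier R \<times> B). f = comb_value R w"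
proof -
  interpret cring R by fact
  have "\<forall>f. f \<in> carrier (free_module R B) \<longrightarrow> {b. f b \<noteq> \<zero>\<^bsub>R\<^esub>} \<subseteq> A \<longrightarrow>
      (\<exists>w\<in>lists (carrier R \<times> B). f = comb_value R w)" if "finite A" for A
    using that
  proof (induction A)
    case empty
    have "f = comb_value R []" if "{b. f b \<noteq> \<zero>\<^bsub>R\<^esub>} \<subseteq> {}" for f :: "'c \<Rightarrow> 'a"
      using that by auto
    then show ?case by (metis lists.Nil)
  next
    case (insert c A)
    show ?case
    proof (intro allI impI)
      fix f assume f: "f \<in> carrier (free_module R B)" "{b. f b \<noteq> \<zero>\<^bsub>R\<^esub>} \<subseteq> insert c A"
      show "\<exists>w\<in>lists (carrier R \<times> B). f = comb_value R w"
      proof (cases "c \<in> B")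
        case True
        have "{b. (f(c := \<zero>\<^bsub>R\<^esub>)) b \<noteq> \<zero>\<^bsub>R\<^esub>} \<subseteq> {b. f b \<noteq> \<zero>\<^bsub>R\<^esub>}" by auto
        then have "f(c := \<zero>\<^bsub>R\<^esub>) \<in> carrier (free_module R B)"
          using f by (auto simp: free_module_simps image_subset_iff intro: finite_subset)
        moreover have "{b. (f(c := \<zero>\<^bsub>R\<^esub>)) b \<noteq> \<zero>\<^bsub>R\<^esub>} \<subseteq> A" using f by auto
        ultimately obtain w where w: "w \<in> lists (carrier R \<times> B)" "f(c := \<zero>\<^bsub>R\<^esub>) = comb_value R w"
          using insert.IH by blast
        have fc: "f c \<in> carrier R" using f by (auto simp: free_module_simps image_subset_iff)
        have "f = comb_value R ((f c, c) # w)"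
          using fc by (auto simp: w(2)[symmetric] fun_eq_iff)
        with w fc True show ?thesis by (intro bexI[of _ "(f c, c) # w"]) auto
      next
        case False
        then have "{b. f b \<noteq> \<zero>\<^bsub>R\<^esub>} \<subseteq> A" using f by (auto simp: free_module_simps)
        then show ?thesis using insert.IH f by blast
      qed
    qed
  qed
  from this[of "{b. f b \<noteq> \<zero>\<^bsub>R\<^esub>}"] assms(2) show ?thesis by (auto simp: free_module_simps)
qed

lemma linear_ext_single:
  assumes "Module.module R N" "b \<in> B" "g \<in> B \<rightarrow> carrier N" "\<one>\<^bsub>R\<^esub> \<noteq> \<zero>\<^bsub>R\<^esub>"
  shows "linear_ext R N g (comb_value R [(\<one>\<^bsub>R\<^esub>, b)]) = g b"
proof -
  interpret Module.module R N by fact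
  have "comb_value R [(\<one>\<^bsub>R\<^esub>, b)] \<in> carrier (free_module R B)"
    using assms(2) by (intro comb_value_closed R.is_cring) auto
  then have "linear_ext R N g (comb_value R [(\<one>\<^bsub>R\<^esub>, b)]) = (\<Oplus>\<^bsub>N\<^esub>c\<in>{b}. comb_value R [(\<one>\<^bsub>R\<^esub>, b)] c \<odot>\<^bsub>N\<^esub> g c)"
    using assms by (intro linear_ext_superset) auto
  also have "\<dots> = g b" using assms(2,3) by (simp add: Pi_iff)
  finally show ?thesis .
qed

lemma linear_ext_in_submodule:
  assumes "Module.module R N" "submodule H R N" "g \<in> B \<rightarrow> H" "f \<in> carrier (free_module R B)"
  shows "linear_ext R N g f \<in> H"
proof -
  interpret Module.module R N by fact
  interpret H: submodule H R N by fact
  have "(\<Oplus>\<^bsub>N\<^esub>b\<in>A. f b \<odot>\<^bsub>N\<^esub> g b) \<in> H" if "finite A" "A \<subseteq> B" for A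
    using that
  proof (induction A)
    case empty then show ?case using H.one_closed by simp
  next
    case (insert x A)
    have *: "f b \<odot>\<^bsub>N\<^esub> g b \<in> H" if "b \<in> B" for b
      using that assms by (auto simp: free_module_simps image_subset_iff)
    then have **: "f b \<odot>\<^bsub>N\<^esub> g b \<in> carrier N" if "b \<in> B" for b
      using that H.subset by auto
    have "(\<Oplus>\<^bsub>N\<^esub>b\<in>insert x A. f b \<odot>\<^bsub>N\<^esub> g b) = f x \<odot>\<^bsub>N\<^esub> g x \<oplus>\<^bsub>N\<^esub> (\<Oplus>\<^bsub>N\<^esub>b\<in>A. f b \<odot>\<^bsub>N\<^esub> g b)"
      using insert.hyps insert.prems ** by (intro M.finsum_insert) auto
    then show ?case using insert * H.m_closed by auto
  qed
  then show ?thesis unfolding linear_ext_def using assms(4) by (auto simp: free_module_simps)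
qed

lemma kernel_submodule:
  assumes "Module.module R F" "Module.module R N"
    "\<And>x. x \<in> carrier F \<Longrightarrow> h x \<in> carrier N"
    "\<And>x y. x \<in> carrier F \<Longrightarrow> y \<in> carrier F \<Longrightarrow> h (x \<oplus>\<^bsub>F\<^esub> y) = h x \<oplus>\<^bsub>N\<^esub> h y"
    "\<And>a x. a \<in> carrier R \<Longrightarrow> x \<in> carrier F \<Longrightarrow> h (a \<odot>\<^bsub>F\<^esub> x) = a \<odot>\<^bsub>N\<^esub> h x"
  shows "submodule {x \<in> carrier F. h x = \<zero>\<^bsub>N\<^esub>} R F"
proof -
  interpret F: Module.module R F by fact
  interpret N: Module.module R N by fact
  have z: "h \<zero>\<^bsub>F\<^esub> = \<zero>\<^bsub>N\<^esub>"
    using assms(5)[of "\<zero>\<^bsub>R\<^esub>" "\<zero>\<^bsub>F\<^esub>"] assms(3)[of "\<zero>\<^bsub>F\<^esub>"] by simp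
  show ?thesis
  proof (rule F.submoduleI)
    fix x assume x: "x \<in> {x \<in> carrier F. h x = \<zero>\<^bsub>N\<^esub>}"
    have "\<ominus>\<^bsub>F\<^esub> x = (\<ominus>\<^bsub>R\<^esub> \<one>\<^bsub>R\<^esub>) \<odot>\<^bsub>F\<^esub> x" using x by (simp add: F.smult_l_minus)
    then have "h (\<ominus>\<^bsub>F\<^esub> x) = \<zero>\<^bsub>N\<^esub>" using x assms(5)[of "\<ominus>\<^bsub>R\<^esub> \<one>\<^bsub>R\<^esub>" x] by simp
    then show "\<ominus>\<^bsub>F\<^esub> x \<in> {x \<in> carrier F. h x = \<zero>\<^bsub>N\<^esub>}" using x by simp
  qed (use z assms(4,5) in auto)
qed

text \<open>
  One step of the construction: if \<open>h\<close> is linear on the free module on \<open>B\<close>, then the free module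
  on the formal combinations with value in \<open>ker h\<close> maps onto \<open>ker h\<close>.
\<close>

lemma free_step_exact:
  assumes "cring R" "\<one>\<^bsub>R\<^esub> \<noteq> \<zero>\<^bsub>R\<^esub>" "submodule K R (free_module R B)"
    and B': "B' = Rel ` {w \<in> lists (carrier R \<times> B). comb_value R w \<in> K}"
  shows "linear_ext R (free_module R B) (comb_value R \<circ> rel) ` carrier (free_module R B') = K"
proof -
  interpret F: Module.module R "free_module R B" by (rule free_module_module) fact
  have K: "K \<subseteq> carrier (free_module R B)" using F.submoduleE(1)[OF assms(3)] .
  have g: "comb_value R \<circ> rel \<in> B' \<rightarrow> K" by (auto simp: B')
  show ?thesis
  proof (intro equalityI subsetI)
    fix k assume "k \<in> linear_ext R (free_module R B) (comb_value R \<circ> rel) ` carrier (free_module R B')"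
    then show "k \<in> K" using linear_ext_in_submodule[OF F.module_axioms assms(3) g] by auto
  next
    fix k assume k: "k \<in> K"
    then obtain w where w: "w \<in> lists (carrier R \<times> B)" "k = comb_value R w"
      using comb_value_surj[OF assms(1)] K by blast
    then have b: "Rel w \<in> B'" using k by (auto simp: B')
    have "k = linear_ext R (free_module R B) (comb_value R \<circ> rel) (comb_value R [(\<one>\<^bsub>R\<^esub>, Rel w)])"
    proof -
      have "comb_value R \<circ> rel \<in> B' \<rightarrow> carrier (free_module R B)" using g K by blast
      from linear_ext_single[OF F.module_axioms b this assms(2)] w(2) show ?thesis by simp
    qed
    moreover have "comb_value R [(\<one>\<^bsub>R\<^esub>, Rel w)] \<in> carrier (free_module R B')"
      using b by (intro comb_value_closed assms) auto
    ultimately show "k \<in> linear_ext R (free_module R B) (comb_value R \<circ> rel) ` carrier (free_module R B')"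
      by blast
  qed
qed

lemma std_basis_Suc:
  "std_basis R M (Suc n) = Rel ` {w \<in> lists (carrier R \<times> std_basis R M n). comb_value R w \<in>
     (if n = 0 then {f \<in> carrier (std_res R M 0). std_aug R M f = \<zero>\<^bsub>M\<^esub>}
      else {f \<in> carrier (std_res R M n). std_diff R M (n - 1) f = \<zero>\<^bsub>std_res R M (n - 1)\<^esub>})}"
  if "cring R"
  using comb_value_closed[OF that]
  by (cases n) (auto simp: std_res_def std_aug_def std_diff_def)

theorem std_res_free_resolution:
  assumes "Module.module R M" "\<one>\<^bsub>R\<^esub> \<noteq> \<zero>\<^bsub>R\<^esub>"
  shows std_aug_hom: "restrict (std_aug R M) (carrier (std_res R M 0)) \<in> mod_hom R (std_res R M 0) M"
    and std_diff_hom: "restrict (std_diff R M n) (carrier (std_res R M (Suc n)))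
          \<in> mod_hom R (std_res R M (Suc n)) (std_res R M n)"
    and std_aug_surj: "std_aug R M ` carrier (std_res R M 0) = carrier M"
    and std_exact_0: "std_diff R M 0 ` carrier (std_res R M 1)
          = {x \<in> carrier (std_res R M 0). std_aug R M x = \<zero>\<^bsub>M\<^esub>}"
    and std_exact_Suc: "std_diff R M (Suc n) ` carrier (std_res R M (Suc (Suc n)))
          = {x \<in> carrier (std_res R M (Suc n)). std_diff R M n x = \<zero>\<^bsub>std_res R M n\<^esub>}"
proof -
  interpret M: Module.module R M by fact
  have cr: "cring R" by (rule M.R.is_cring)
  interpret F: Module.module R "std_res R M n" for n
    unfolding std_res_def by (rule free_module_module[OF cr])
  have g0: "elt \<in> std_basis R M 0 \<rightarrow> carrier M" by auto
  have gS: "comb_value R \<circ> rel \<in> std_basis R M (Suc n) \<rightarrow> carrier (std_res R M n)" for n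
    using comb_value_closed[OF cr] by (auto simp: std_basis_Suc[OF cr] std_res_def)
  note l0 = linear_ext_hom[OF M.module_axioms g0, folded std_res_def std_aug_def]
  have lS: "f \<in> carrier (std_res R M (Suc n)) \<Longrightarrow> std_diff R M n f \<in> carrier (std_res R M n)"
    "f \<in> carrier (std_res R M (Suc n)) \<Longrightarrow> h \<in> carrier (std_res R M (Suc n)) \<Longrightarrow>
      std_diff R M n (f \<oplus>\<^bsub>std_res R M (Suc n)\<^esub> h) = std_diff R M n f \<oplus>\<^bsub>std_res R M n\<^esub> std_diff R M n h"
    "a \<in> carrier R \<Longrightarrow> f \<in> carrier (std_res R M (Suc n)) \<Longrightarrow>
      std_diff R M n (a \<odot>\<^bsub>std_res R M (Suc n)\<^esub> f) = a \<odot>\<^bsub>std_res R M n\<^esub> std_diff R M n f" for n f h a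
    using linear_ext_hom[OF F.module_axioms[of n] gS[of n]] by (simp_all add: std_diff_def std_res_def)
  show "restrict (std_aug R M) (carrier (std_res R M 0)) \<in> mod_hom R (std_res R M 0) M"
    using l0 by (auto simp: mod_hom_def)
  show "restrict (std_diff R M n) (carrier (std_res R M (Suc n)))
          \<in> mod_hom R (std_res R M (Suc n)) (std_res R M n)" for n
    using lS by (auto simp: mod_hom_def)
  show "std_aug R M ` carrier (std_res R M 0) = carrier M"
  proof (intro equalityI subsetI)
    fix m assume m: "m \<in> carrier M"
    then have b: "Elt m \<in> std_basis R M 0" by auto
    have "std_aug R M (comb_value R [(\<one>\<^bsub>R\<^esub>, Elt m)]) = m"
      unfolding std_aug_def using linear_ext_single[OF M.module_axioms b g0 assms(2)] by simp
    moreover have "comb_value R [(\<one>\<^bsub>R\<^esub>, Elt m)] \<in> carrier (std_res R M 0)"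
      unfolding std_res_def using b by (intro comb_value_closed cr) auto
    ultimately show "m \<in> std_aug R M ` carrier (std_res R M 0)" by (metis imageI)
  qed (use l0(1) in auto)
  have K0: "submodule {x \<in> carrier (std_res R M 0). std_aug R M x = \<zero>\<^bsub>M\<^esub>} R (std_res R M 0)"
    by (rule kernel_submodule[OF F.module_axioms M.module_axioms]) (simp_all add: l0)
  show "std_diff R M 0 ` carrier (std_res R M 1)
          = {x \<in> carrier (std_res R M 0). std_aug R M x = \<zero>\<^bsub>M\<^esub>}"
  proof -
    have "std_basis R M 1 = Rel ` {w \<in> lists (carrier R \<times> std_basis R M 0).
        comb_value R w \<in> {x \<in> carrier (std_res R M 0). std_aug R M x = \<zero>\<^bsub>M\<^esub>}}"
      unfolding One_nat_def by (subst std_basis_Suc[OF cr]) simp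
    from free_step_exact[OF cr assms(2) _ this] K0 show ?thesis
      by (simp add: std_diff_def std_res_def del: std_basis.simps)
  qed
  have KS: "submodule {x \<in> carrier (std_res R M (Suc n)). std_diff R M n x = \<zero>\<^bsub>std_res R M n\<^esub>} R (std_res R M (Suc n))" for n
    by (rule kernel_submodule[OF F.module_axioms F.module_axioms]) (simp_all add: lS)
  show "std_diff R M (Suc n) ` carrier (std_res R M (Suc (Suc n)))
          = {x \<in> carrier (std_res R M (Suc n)). std_diff R M n x = \<zero>\<^bsub>std_res R M n\<^esub>}" for n
  proof -
    have "std_basis R M (Suc (Suc n)) = Rel ` {w \<in> lists (carrier R \<times> std_basis R M (Suc n)).
        comb_value R w \<in> {x \<in> carrier (std_res R M (Suc n)). std_diff R M n x = \<zero>\<^bsub>std_res R M n\<^esub>}}"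
      by (subst std_basis_Suc[OF cr]) simp
    from free_step_exact[OF cr assms(2) _ this] KS[of n] show ?thesis
      by (simp add: std_diff_def std_res_def)
  qed
qed


lemma Hom_module_module:
  assumes "Module.module R F" "Module.module R N"
  shows "Module.module R (Hom_module R F N)"
proof -
  interpret F: Module.module R F by fact
  interpret N: Module.module R N by fact
  have ag: "abelian_group (Hom_module R F N)"
  proof (rule abelian_groupI)
    fix f assume f: "f \<in> carrier (Hom_module R F N)"
    have "(\<lambda>x\<in>carrier F. \<ominus>\<^bsub>N\<^esub> f x) \<in> mod_hom R F N"
      using f by (auto simp: Hom_module_def mod_hom_def PiE_iff N.minus_add N.smult_r_minus)
    moreover have "(\<lambda>x\<in>carrier F. \<ominus>\<^bsub>N\<^esub> f x) \<oplus>\<^bsub>Hom_module R F N\<^esub> f = \<zero>\<^bsub>Hom_module R F N\<^esub>"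
      using f by (auto simp: Hom_module_def mod_hom_def PiE_iff N.l_neg)
    ultimately show "\<exists>g\<in>carrier (Hom_module R F N). g \<oplus>\<^bsub>Hom_module R F N\<^esub> f = \<zero>\<^bsub>Hom_module R F N\<^esub>"
      by (intro bexI[of _ "\<lambda>x\<in>carrier F. \<ominus>\<^bsub>N\<^esub> f x"]) (simp_all add: Hom_module_def)
  qed (auto simp: Hom_module_def mod_hom_def PiE_iff N.a_ac N.smult_r_distr extensional_def fun_eq_iff)
  then show ?thesis
    by (intro moduleI F.R.is_cring)
      (auto simp: Hom_module_def mod_hom_def PiE_iff N.smult_r_distr N.smult_l_distr F.R.m_comm
        N.smult_assoc1[symmetric] extensional_def fun_eq_iff)
qed

lemma quotient_module_module:
  assumes "Module.module R M" "submodule H R M"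
  shows "Module.module R (quotient_module M H)"
proof -
  interpret M: Module.module R M by fact
  interpret H: submodule H R M by fact
  interpret A: abelian_subgroup H M
    by (intro abelian_subgroupI3 additive_subgroupI M.abelian_group_axioms H.subgroup_axioms)
  let ?Q = "quotient_module M H"
  have rep: "\<exists>x\<in>carrier M. X = a_r_coset M H x" if "X \<in> carrier ?Q" for X
    using that unfolding quotient_module_def by (auto simp: A_RCOSETS_def' )
  have cl: "a_r_coset M H x \<in> carrier ?Q" if "x \<in> carrier M" for x
    using that unfolding quotient_module_def by (auto simp: A_RCOSETS_def')
  have add: "a_r_coset M H x \<oplus>\<^bsub>?Q\<^esub> a_r_coset M H y = a_r_coset M H (x \<oplus>\<^bsub>M\<^esub> y)"
    if "x \<in> carrier M" "y \<in> carrier M" for x y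
    using that A.a_rcos_sum by (simp add: quotient_module_def)
  have sm: "a \<odot>\<^bsub>?Q\<^esub> a_r_coset M H x = a_r_coset M H (a \<odot>\<^bsub>M\<^esub> x)"
    if a: "a \<in> carrier R" and x: "x \<in> carrier M" for a x
  proof -
    have *: "a_r_coset M H (a \<odot>\<^bsub>M\<^esub> y) = a_r_coset M H (a \<odot>\<^bsub>M\<^esub> x)" if y: "y \<in> a_r_coset M H x" for y
    proof -
      obtain h where h: "h \<in> H" "y = h \<oplus>\<^bsub>M\<^esub> x" using y by (auto simp: a_r_coset_def')
      have hM: "h \<in> carrier M" using h H.subset by auto
      have "a \<odot>\<^bsub>M\<^esub> y = a \<odot>\<^bsub>M\<^esub> h \<oplus>\<^bsub>M\<^esub> a \<odot>\<^bsub>M\<^esub> x" using h hM a x by (simp add: M.smult_r_distr)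
      then have "a \<odot>\<^bsub>M\<^esub> y \<in> a_r_coset M H (a \<odot>\<^bsub>M\<^esub> x)" using h a by (auto simp: a_r_coset_def')
      then show ?thesis using M.a_repr_independence a x H.subgroup_axioms by (metis M.smult_closed)
    qed
    have "x \<in> a_r_coset M H x" using x by (rule A.a_rcos_self)
    then have "(\<Union>y\<in>a_r_coset M H x. a_r_coset M H (a \<odot>\<^bsub>M\<^esub> y)) = a_r_coset M H (a \<odot>\<^bsub>M\<^esub> x)"
      using * by blast
    then show ?thesis by (simp add: quotient_module_def)
  qed
  have z: "\<zero>\<^bsub>?Q\<^esub> = a_r_coset M H \<zero>\<^bsub>M\<^esub>"
    using H.subset by (simp add: quotient_module_def M.a_coset_add_zero)
  have ag: "abelian_group ?Q"
  proof (rule abelian_groupI)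
    fix X assume "X \<in> carrier ?Q"
    then obtain x where x: "x \<in> carrier M" "X = a_r_coset M H x" using rep by blast
    show "\<exists>Y\<in>carrier ?Q. Y \<oplus>\<^bsub>?Q\<^esub> X = \<zero>\<^bsub>?Q\<^esub>"
      using x by (intro bexI[of _ "a_r_coset M H (\<ominus>\<^bsub>M\<^esub> x)"]) (simp_all add: add z cl M.l_neg)
  next
    show "\<zero>\<^bsub>?Q\<^esub> \<in> carrier ?Q" by (simp add: z cl)
    show "X \<oplus>\<^bsub>?Q\<^esub> Y \<in> carrier ?Q" if "X \<in> carrier ?Q" "Y \<in> carrier ?Q" for X Y
      using that[THEN rep] by (auto simp: add cl)
    show "X \<oplus>\<^bsub>?Q\<^esub> Y \<oplus>\<^bsub>?Q\<^esub> Z = X \<oplus>\<^bsub>?Q\<^esub> (Y \<oplus>\<^bsub>?Q\<^esub> Z)"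
      if "X \<in> carrier ?Q" "Y \<in> carrier ?Q" "Z \<in> carrier ?Q" for X Y Z
      using that[THEN rep] by (auto simp: add M.a_assoc)
    show "X \<oplus>\<^bsub>?Q\<^esub> Y = Y \<oplus>\<^bsub>?Q\<^esub> X" if "X \<in> carrier ?Q" "Y \<in> carrier ?Q" for X Y
      using that[THEN rep] by (auto simp: add M.a_comm)
    show "\<zero>\<^bsub>?Q\<^esub> \<oplus>\<^bsub>?Q\<^esub> X = X" if "X \<in> carrier ?Q" for X
      using that[THEN rep] by (auto simp: add z)
  qed
  then show ?thesis
  proof (rule moduleI[OF M.R.is_cring])
    show "a \<odot>\<^bsub>?Q\<^esub> X \<in> carrier ?Q" if "a \<in> carrier R" "X \<in> carrier ?Q" for a X
      using that(1) that(2)[THEN rep] by (auto simp: sm cl)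
    show "(a \<oplus>\<^bsub>R\<^esub> b) \<odot>\<^bsub>?Q\<^esub> X = a \<odot>\<^bsub>?Q\<^esub> X \<oplus>\<^bsub>?Q\<^esub> b \<odot>\<^bsub>?Q\<^esub> X"
      if "a \<in> carrier R" "b \<in> carrier R" "X \<in> carrier ?Q" for a b X
      using that(1,2) that(3)[THEN rep] by (auto simp: sm add M.smult_l_distr)
    show "a \<odot>\<^bsub>?Q\<^esub> (X \<oplus>\<^bsub>?Q\<^esub> Y) = a \<odot>\<^bsub>?Q\<^esub> X \<oplus>\<^bsub>?Q\<^esub> a \<odot>\<^bsub>?Q\<^esub> Y"
      if "a \<in> carrier R" "X \<in> carrier ?Q" "Y \<in> carrier ?Q" for a X Y
      using that(1) that(2,3)[THEN rep] by (auto simp: sm add M.smult_r_distr)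
    show "(a \<otimes>\<^bsub>R\<^esub> b) \<odot>\<^bsub>?Q\<^esub> X = a \<odot>\<^bsub>?Q\<^esub> (b \<odot>\<^bsub>?Q\<^esub> X)"
      if "a \<in> carrier R" "b \<in> carrier R" "X \<in> carrier ?Q" for a b X
      using that(1,2) that(3)[THEN rep] by (auto simp: sm M.smult_assoc1)
    show "\<one>\<^bsub>R\<^esub> \<odot>\<^bsub>?Q\<^esub> X = X" if "X \<in> carrier ?Q" for X
      using that[THEN rep] by (auto simp: sm)
  qed
qed


lemma Hom_cohomology_module:
  assumes F: "\<And>n. Module.module R (F n)" and N: "Module.module R N"
    and d: "\<And>n. restrict (d n) (carrier (F (Suc n))) \<in> mod_hom R (F (Suc n)) (F n)"
    and dd: "\<And>n x. x \<in> carrier (F (Suc (Suc n))) \<Longrightarrow> d n (d (Suc n) x) = \<zero>\<^bsub>F n\<^esub>"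
  shows "Module.module R (Hom_cohomology R F d N i)"
proof -
  interpret N: Module.module R N by fact
  interpret F: Module.module R "F n" for n by (rule F)
  interpret H: Module.module R "Hom_module R (F n) N" for n by (intro Hom_module_module F N)
  have d1: "d n x \<in> carrier (F n)" if "x \<in> carrier (F (Suc n))" for n x
    using d[of n] that by (auto simp: mod_hom_def PiE_iff)
  have d2: "d n (x \<oplus>\<^bsub>F (Suc n)\<^esub> y) = d n x \<oplus>\<^bsub>F n\<^esub> d n y" if "x \<in> carrier (F (Suc n))" "y \<in> carrier (F (Suc n))" for n x y
    using d[of n] that by (auto simp: mod_hom_def)
  have d3: "d n (a \<odot>\<^bsub>F (Suc n)\<^esub> x) = a \<odot>\<^bsub>F n\<^esub> d n x" if "x \<in> carrier (F (Suc n))" "a \<in> carrier R" for n x a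
    using d[of n] that by (auto simp: mod_hom_def)
  have hz: "f \<zero>\<^bsub>F n\<^esub> = \<zero>\<^bsub>N\<^esub>" if "f \<in> mod_hom R (F n) N" for f n
  proof -
    have "f (\<zero>\<^bsub>R\<^esub> \<odot>\<^bsub>F n\<^esub> \<zero>\<^bsub>F n\<^esub>) = \<zero>\<^bsub>R\<^esub> \<odot>\<^bsub>N\<^esub> f \<zero>\<^bsub>F n\<^esub>" "f \<zero>\<^bsub>F n\<^esub> \<in> carrier N"
      using that by (auto simp: mod_hom_def simp del: F.smult_l_null F.smult_r_null)
    then show ?thesis by simp
  qed
  have subm: "submodule H R (Hom_module R (F n) N)"
    if "H \<subseteq> mod_hom R (F n) N" "\<zero>\<^bsub>Hom_module R (F n) N\<^esub> \<in> H"
       "\<And>f g. f \<in> H \<Longrightarrow> g \<in> H \<Longrightarrow> f \<oplus>\<^bsub>Hom_module R (F n) N\<^esub> g \<in> H"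
       "\<And>a f. a \<in> carrier R \<Longrightarrow> f \<in> H \<Longrightarrow> a \<odot>\<^bsub>Hom_module R (F n) N\<^esub> f \<in> H" for H n
  proof (rule H.submoduleI)
    show "H \<subseteq> carrier (Hom_module R (F n) N)" using that(1) by (simp add: Hom_module_def)
    then have "\<ominus>\<^bsub>Hom_module R (F n) N\<^esub> f = (\<ominus>\<^bsub>R\<^esub> \<one>\<^bsub>R\<^esub>) \<odot>\<^bsub>Hom_module R (F n) N\<^esub> f" if "f \<in> H" for f
      using that by (auto simp: H.smult_l_minus)
    then show "\<ominus>\<^bsub>Hom_module R (F n) N\<^esub> f \<in> H" if "f \<in> H" for f
      using that \<open>\<And>a f. a \<in> carrier R \<Longrightarrow> f \<in> H \<Longrightarrow> a \<odot>\<^bsub>Hom_module R (F n) N\<^esub> f \<in> H\<close> by auto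
  qed (use that in auto)
  have Z: "submodule (Hom_cocycles R F d N i) R (Hom_module R (F i) N)"
  proof (rule subm)
    show "\<zero>\<^bsub>Hom_module R (F i) N\<^esub> \<in> Hom_cocycles R F d N i"
      using H.M.zero_closed[of i] d1 by (auto simp: Hom_cocycles_def Hom_module_def)
    show "f \<oplus>\<^bsub>Hom_module R (F i) N\<^esub> g \<in> Hom_cocycles R F d N i"
      if "f \<in> Hom_cocycles R F d N i" "g \<in> Hom_cocycles R F d N i" for f g
      using that H.M.add.m_closed[of f i g] d1 by (auto simp: Hom_cocycles_def Hom_module_def)
    show "a \<odot>\<^bsub>Hom_module R (F i) N\<^esub> f \<in> Hom_cocycles R F d N i"
      if "a \<in> carrier R" "f \<in> Hom_cocycles R F d N i" for a f
      using that H.smult_closed[of a f i] d1 by (auto simp: Hom_cocycles_def Hom_module_def)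
  qed (auto simp: Hom_cocycles_def)
  have pull: "(\<lambda>x\<in>carrier (F (Suc j)). g (d j x)) \<in> mod_hom R (F (Suc j)) N" if "g \<in> mod_hom R (F j) N" for g j
    using that d1 d2 d3 by (auto simp: mod_hom_def PiE_iff)
  have B0: "submodule (Hom_coboundaries R F d N i) R (Hom_module R (F i) N)"
  proof (cases i)
    case 0
    then show ?thesis
      by (intro subm) (use H.M.zero_closed[of 0] H.M.l_zero[OF H.M.zero_closed[of 0]] H.smult_r_null[of _ 0] in \<open>auto simp: Hom_coboundaries_def Hom_module_def\<close>)
  next
    case (Suc j)
    show ?thesis unfolding Suc
    proof (rule subm)
      show "Hom_coboundaries R F d N (Suc j) \<subseteq> mod_hom R (F (Suc j)) N"
        using pull by (auto simp: Hom_coboundaries_def)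
      have "\<zero>\<^bsub>Hom_module R (F (Suc j)) N\<^esub> = (\<lambda>x\<in>carrier (F (Suc j)). \<zero>\<^bsub>Hom_module R (F j) N\<^esub> (d j x))"
        using d1 by (auto simp: Hom_module_def)
      moreover have "\<zero>\<^bsub>Hom_module R (F j) N\<^esub> \<in> mod_hom R (F j) N"
        using H.M.zero_closed[of j] by (simp add: Hom_module_def)
      ultimately show "\<zero>\<^bsub>Hom_module R (F (Suc j)) N\<^esub> \<in> Hom_coboundaries R F d N (Suc j)"
        by (auto simp: Hom_coboundaries_def)
    next
      fix f g assume "f \<in> Hom_coboundaries R F d N (Suc j)" "g \<in> Hom_coboundaries R F d N (Suc j)"
      then obtain f' g' where fg: "f' \<in> mod_hom R (F j) N" "g' \<in> mod_hom R (F j) N"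
         "f = (\<lambda>x\<in>carrier (F (Suc j)). f' (d j x))" "g = (\<lambda>x\<in>carrier (F (Suc j)). g' (d j x))"
        by (auto simp: Hom_coboundaries_def)
      then have "f \<oplus>\<^bsub>Hom_module R (F (Suc j)) N\<^esub> g = (\<lambda>x\<in>carrier (F (Suc j)). (f' \<oplus>\<^bsub>Hom_module R (F j) N\<^esub> g') (d j x))"
        using d1 by (auto simp: Hom_module_def)
      moreover have "f' \<oplus>\<^bsub>Hom_module R (F j) N\<^esub> g' \<in> mod_hom R (F j) N"
        using H.M.add.m_closed[of f' j g'] fg by (simp add: Hom_module_def)
      ultimately show "f \<oplus>\<^bsub>Hom_module R (F (Suc j)) N\<^esub> g \<in> Hom_coboundaries R F d N (Suc j)"
        by (auto simp: Hom_coboundaries_def)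
    next
      fix a f assume "a \<in> carrier R" "f \<in> Hom_coboundaries R F d N (Suc j)"
      then obtain f' where fg: "a \<in> carrier R" "f' \<in> mod_hom R (F j) N"
         "f = (\<lambda>x\<in>carrier (F (Suc j)). f' (d j x))"
        by (auto simp: Hom_coboundaries_def)
      then have "a \<odot>\<^bsub>Hom_module R (F (Suc j)) N\<^esub> f = (\<lambda>x\<in>carrier (F (Suc j)). (a \<odot>\<^bsub>Hom_module R (F j) N\<^esub> f') (d j x))"
        using d1 by (auto simp: Hom_module_def)
      moreover have "a \<odot>\<^bsub>Hom_module R (F j) N\<^esub> f' \<in> mod_hom R (F j) N"
        using H.smult_closed[of a f' j] fg by (simp add: Hom_module_def)
      ultimately show "a \<odot>\<^bsub>Hom_module R (F (Suc j)) N\<^esub> f \<in> Hom_coboundaries R F d N (Suc j)"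
        by (auto simp: Hom_coboundaries_def)
    qed
  qed
  have BZ: "Hom_coboundaries R F d N i \<subseteq> Hom_cocycles R F d N i"
  proof (cases i)
    case 0
    then show ?thesis using Z H.submoduleE(1)[OF Z] submodule.axioms(1)[OF Z, THEN subgroup.one_closed]
      by (auto simp: Hom_coboundaries_def)
  next
    case (Suc j)
    then show ?thesis using pull d1 dd hz by (auto simp: Hom_coboundaries_def Hom_cocycles_def)
  qed
  let ?Z = "(Hom_module R (F i) N)\<lparr>carrier := Hom_cocycles R F d N i\<rparr>"
  have Zm: "Module.module R ?Z" by (rule submodule.submodule_is_module[OF Z H.module_axioms])
  interpret Z: Module.module R ?Z by (rule Zm)
  have "submodule (Hom_coboundaries R F d N i) R ?Z"
  proof (rule Z.module_incl_imp_submodule)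
    show "Module.module R (?Z\<lparr>carrier := Hom_coboundaries R F d N i\<rparr>)"
      using submodule.submodule_is_module[OF B0 H.module_axioms] by simp
  qed (use BZ in simp)
  then show ?thesis unfolding Hom_cohomology_def by (rule quotient_module_module[OF Zm])
qed

lemma Ext_module:
  assumes M: "Module.module R M" and N: "Module.module R N" and "\<one>\<^bsub>R\<^esub> \<noteq> \<zero>\<^bsub>R\<^esub>"
  shows "Module.module R (Ext R i M N)"
  unfolding Ext_def
proof (rule Hom_cohomology_module[OF _ N])
  have cr: "cring R" using M by (simp add: Module.module_def)
  show "Module.module R (std_res R M n)" for n
    unfolding std_res_def by (rule free_module_module[OF cr])
  show "restrict (std_diff R M n) (carrier (std_res R M (Suc n))) \<in> mod_hom R (std_res R M (Suc n)) (std_res R M n)" for n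
    by (rule std_diff_hom[OF assms(1,3)])
  show "std_diff R M n (std_diff R M (Suc n) x) = \<zero>\<^bsub>std_res R M n\<^esub>"
    if "x \<in> carrier (std_res R M (Suc (Suc n)))" for n x
    using std_exact_Suc[OF assms(1,3), of n] that by blast
qed

end

theory Submission
  imports Defs
begin

text \<open>
  The equality holds for each \<open>i\<close> separately and for an arbitrary \<open>R\<close>-module \<open>E\<close> in place of
  \<open>Ext\<^sup>i(M, R)\<close>.  A prime \<open>P\<close> lies in \<open>Supp E\<close> iff some \<open>x\<close> in \<open>E\<close> has annihilator contained in
  \<open>P\<close>.  If moreover \<open>P = ann y\<close> for some \<open>y\<close> in the reduced ring \<open>R\<close>, then \<open>y\<close> is not in \<open>P\<close>, as
  otherwise \<open>y\<^sup>2 = 0\<close>.  Hence \<open>P\<close> kills \<open>y x\<close>, while \<open>a y x = 0\<close> forces \<open>a y\<close>, and so \<open>a\<close>, into \<open>P\<close>;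
  thus \<open>P = ann (y x)\<close>.
\<close>

text \<open>If \<open>x/s = 0/1\<close>, then the pair \<open>(x, s)\<close> lies in the class of
  \<open>0/1\<close>, whose numerators are killed by elements outside \<open>P\<close>. Conversely,
  an element \<open>u\<close> killing \<open>x\<close> can be multiplied into any multiplier, which
  makes the part of the relation coming from \<open>x\<close> vanish.\<close>

lemma frac_rel_class_eq_zero_iff:
  assumes "Module.module R E" "primeideal P R" "x \<in> carrier E" "s \<in> carrier R - P"
  shows "frac_rel R (carrier R - P) E `` {(x, s)} = frac_rel R (carrier R - P) E `` {(\<zero>\<^bsub>E\<^esub>, \<one>\<^bsub>R\<^esub>)}
    \<longleftrightarrow> (\<exists>u\<in>carrier R - P. u \<odot>\<^bsub>E\<^esub> x = \<zero>\<^bsub>E\<^esub>)"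
    (is "?L = ?Z \<longleftrightarrow> _")
proof -
  interpret E: Module.module R E by fact
  interpret P: primeideal P R by fact
  have one: "\<one>\<^bsub>R\<^esub> \<in> carrier R - P"
    using P.I_notcarr P.one_imp_carrier by auto
  have mult: "a \<otimes>\<^bsub>R\<^esub> b \<in> carrier R - P" if "a \<in> carrier R - P" "b \<in> carrier R - P" for a b
    using that P.I_prime by auto
  have Z: "(n, t) \<in> ?Z \<longleftrightarrow> n \<in> carrier E \<and> t \<in> carrier R - P \<and> (\<exists>v\<in>carrier R - P. v \<odot>\<^bsub>E\<^esub> n = \<zero>\<^bsub>E\<^esub>)"
    for n t
    using one by (auto simp: frac_rel_def) (metis DiffI)
  have L: "(n, t) \<in> ?L \<longleftrightarrow> n \<in> carrier E \<and> t \<in> carrier R - P \<and>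
      (\<exists>v\<in>carrier R - P. v \<odot>\<^bsub>E\<^esub> (t \<odot>\<^bsub>E\<^esub> x) = v \<odot>\<^bsub>E\<^esub> (s \<odot>\<^bsub>E\<^esub> n))" for n t
    using assms(3,4) by (auto simp: frac_rel_def)
  show ?thesis
  proof
    assume "?L = ?Z"
    \<comment> \<open>Reflexivity at \<open>(x, s)\<close>, with multiplier
      \<open>1\<close>.\<close>
    moreover have "(x, s) \<in> ?L"
      unfolding L using assms(3,4) one by blast
    ultimately show "\<exists>u\<in>carrier R - P. u \<odot>\<^bsub>E\<^esub> x = \<zero>\<^bsub>E\<^esub>"
      using Z by blast
  next
    assume "\<exists>u\<in>carrier R - P. u \<odot>\<^bsub>E\<^esub> x = \<zero>\<^bsub>E\<^esub>"
    then obtain u where u: "u \<in> carrier R - P" "u \<odot>\<^bsub>E\<^esub> x = \<zero>\<^bsub>E\<^esub>" by blast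
    have kill: "(u \<otimes>\<^bsub>R\<^esub> v) \<odot>\<^bsub>E\<^esub> (t \<odot>\<^bsub>E\<^esub> x) = \<zero>\<^bsub>E\<^esub>"
      if "v \<in> carrier R" "t \<in> carrier R" for v t
    proof -
      have "(u \<otimes>\<^bsub>R\<^esub> v) \<odot>\<^bsub>E\<^esub> (t \<odot>\<^bsub>E\<^esub> x) = (v \<otimes>\<^bsub>R\<^esub> t \<otimes>\<^bsub>R\<^esub> u) \<odot>\<^bsub>E\<^esub> x"
        using that u(1) assms(3) by (simp add: E.smult_assoc1[symmetric] E.R.m_ac)
      then show ?thesis
        using that u assms(3) by (simp add: E.smult_assoc1)
    qed
    \<comment> \<open>The classes are compared as sets of pairs. From left to right, a witness
      \<open>v\<close> becomes \<open>u v s\<close>, which kills \<open>n\<close>. From right to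
      left it becomes \<open>u v\<close>, which makes both sides of the relation zero. Both stay
      outside the prime \<open>P\<close> by \<open>mult\<close>.\<close>
    have "(n, t) \<in> ?L \<longleftrightarrow> (n, t) \<in> ?Z" for n t
    proof
      assume "(n, t) \<in> ?L"
      then obtain v where v: "n \<in> carrier E" "t \<in> carrier R - P" "v \<in> carrier R - P"
          "v \<odot>\<^bsub>E\<^esub> (t \<odot>\<^bsub>E\<^esub> x) = v \<odot>\<^bsub>E\<^esub> (s \<odot>\<^bsub>E\<^esub> n)"
        unfolding L by blast
      have "(u \<otimes>\<^bsub>R\<^esub> v \<otimes>\<^bsub>R\<^esub> s) \<odot>\<^bsub>E\<^esub> n = u \<odot>\<^bsub>E\<^esub> (v \<odot>\<^bsub>E\<^esub> (s \<odot>\<^bsub>E\<^esub> n))"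
        using v u assms(4) by (simp add: E.smult_assoc1)
      also have "\<dots> = (u \<otimes>\<^bsub>R\<^esub> v) \<odot>\<^bsub>E\<^esub> (t \<odot>\<^bsub>E\<^esub> x)"
        unfolding v(4)[symmetric] using v(2,3) u assms(3) by (simp add: E.smult_assoc1)
      also have "\<dots> = \<zero>\<^bsub>E\<^esub>" using v(2,3) by (intro kill) auto
      finally show "(n, t) \<in> ?Z"
        unfolding Z using mult[OF mult[OF u(1) v(3)] assms(4)] v(1,2) by blast
    next
      assume "(n, t) \<in> ?Z"
      then obtain v where v: "n \<in> carrier E" "t \<in> carrier R - P" "v \<in> carrier R - P"
          "v \<odot>\<^bsub>E\<^esub> n = \<zero>\<^bsub>E\<^esub>"
        unfolding Z by blast
      have "(u \<otimes>\<^bsub>R\<^esub> v) \<odot>\<^bsub>E\<^esub> (s \<odot>\<^bsub>E\<^esub> n) = (u \<otimes>\<^bsub>R\<^esub> s \<otimes>\<^bsub>R\<^esub> v) \<odot>\<^bsub>E\<^esub> n"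
        using v(1-3) u(1) assms(4) by (simp add: E.smult_assoc1[symmetric] E.R.m_ac)
      also have "\<dots> = \<zero>\<^bsub>E\<^esub>"
        using v u(1) assms(4) by (simp add: E.smult_assoc1)
      finally have "(u \<otimes>\<^bsub>R\<^esub> v) \<odot>\<^bsub>E\<^esub> (t \<odot>\<^bsub>E\<^esub> x) = (u \<otimes>\<^bsub>R\<^esub> v) \<odot>\<^bsub>E\<^esub> (s \<odot>\<^bsub>E\<^esub> n)"
        using kill v(2,3) by simp
      then show "(n, t) \<in> ?L"
        unfolding L using mult[OF u(1) v(3)] v(1,2) by blast
    qed
    then show "?L = ?Z" by (simp add: set_eq_iff)
  qed
qed

text \<open>A fraction \<open>x/s\<close> vanishes exactly when \<open>x\<close> is killed by an
  element outside \<open>P\<close>, whatever \<open>s\<close> is. So the localization is nonzero iff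
  for some \<open>x\<close> no such element exists.\<close>

lemma Supp_iff_annihilator_subset:
  assumes "Module.module R E"
  shows "P \<in> Supp R E \<longleftrightarrow> primeideal P R \<and> (\<exists>x\<in>carrier E. annihilator R E x \<subseteq> P)"
proof (cases "primeideal P R")
  case True
  interpret E: Module.module R E by fact
  interpret P: primeideal P R by fact
  let ?S = "carrier R - P"
  let ?cl = "\<lambda>p. frac_rel R ?S E `` {p}"
  have one: "\<one>\<^bsub>R\<^esub> \<in> ?S"
    using P.I_notcarr P.one_imp_carrier by auto
  have carr: "carrier (localization R ?S E) = ?cl ` (carrier E \<times> ?S)"
    by (auto simp: localization_def quotient_def)
  have zero: "\<zero>\<^bsub>localization R ?S E\<^esub> = ?cl (\<zero>\<^bsub>E\<^esub>, \<one>\<^bsub>R\<^esub>)"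
    by (simp add: localization_def)
  have "P \<in> Supp R E \<longleftrightarrow> (\<exists>x\<in>carrier E. \<exists>s\<in>?S. ?cl (x, s) \<noteq> ?cl (\<zero>\<^bsub>E\<^esub>, \<one>\<^bsub>R\<^esub>))"
  proof -
    have "\<zero>\<^bsub>localization R ?S E\<^esub> \<in> carrier (localization R ?S E)"
      unfolding carr zero using one by blast
    \<comment> \<open>Since zero belongs to the carrier, differing from the singleton of zero means
      having a nonzero element.\<close>
    then have "P \<in> Supp R E \<longleftrightarrow>
        (\<exists>X\<in>carrier (localization R ?S E). X \<noteq> \<zero>\<^bsub>localization R ?S E\<^esub>)"
      using True by (simp add: Supp_def) blast
    then show ?thesis unfolding carr zero by simp
  qed
  also have "\<dots> \<longleftrightarrow> (\<exists>x\<in>carrier E. \<exists>s\<in>?S. \<not> (\<exists>u\<in>?S. u \<odot>\<^bsub>E\<^esub> x = \<zero>\<^bsub>E\<^esub>))"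
    by (intro bex_cong refl) (simp only: frac_rel_class_eq_zero_iff[OF assms True])
  \<comment> \<open>The condition no longer mentions \<open>s\<close>, so its quantifier drops out
    because \<open>?S\<close> contains \<open>1\<close>.\<close>
  also have "\<dots> \<longleftrightarrow> (\<exists>x\<in>carrier E. \<not> (\<exists>u\<in>?S. u \<odot>\<^bsub>E\<^esub> x = \<zero>\<^bsub>E\<^esub>))"
    using one by blast
  also have "\<dots> \<longleftrightarrow> (\<exists>x\<in>carrier E. annihilator R E x \<subseteq> P)"
    by (auto simp: annihilator_def)
  finally show ?thesis using True by simp
qed (simp add: Supp_def)

lemma Ass_subset_Supp:
  assumes "Module.module R E"
  shows "Ass R E \<subseteq> Supp R E"
  using Supp_iff_annihilator_subset[OF assms] by (auto simp: Ass_def)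

lemma Ass_self_Int_Supp_subset_Ass:
  assumes "reduced_ring R" "Module.module R E"
  shows "Ass R (self_module R) \<inter> Supp R E \<subseteq> Ass R E"
proof
  fix P assume P: "P \<in> Ass R (self_module R) \<inter> Supp R E"
  interpret E: Module.module R E by fact
  from P obtain y where y: "y \<in> carrier R" and Py: "P = {a \<in> carrier R. a \<otimes>\<^bsub>R\<^esub> y = \<zero>\<^bsub>R\<^esub>}"
    by (auto simp: Ass_def annihilator_def self_module_def)
  then have mult_y: "a \<otimes>\<^bsub>R\<^esub> y = \<zero>\<^bsub>R\<^esub>" if "a \<in> P" for a
    using that by simp
  from P interpret P: primeideal P R by (simp add: Ass_def)
  from P have "P \<in> Supp R E" by simp
  then obtain x where x: "x \<in> carrier E" and ann: "annihilator R E x \<subseteq> P"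
    unfolding Supp_iff_annihilator_subset[OF assms(2)] by blast
  have yP: "y \<notin> P"
  proof
    assume "y \<in> P"
    \<comment> \<open>Taking \<open>a = y\<close> in \<open>mult_y\<close> gives the vanishing
      square that reducedness excludes for nonzero \<open>y\<close>.\<close>
    then have "y [^]\<^bsub>R\<^esub> Suc (Suc 0) = \<zero>\<^bsub>R\<^esub>"
      using y mult_y by simp
    then have "y = \<zero>\<^bsub>R\<^esub>"
      using assms(1) y unfolding reduced_ring_def by blast
    \<comment> \<open>Every ring element annihilates \<open>y = 0\<close>, so \<open>P\<close> would
      not be proper.\<close>
    then have "carrier R \<subseteq> P" unfolding Py by auto
    then show False using P.I_notcarr P.a_subset by blast
  qed
  have "P = annihilator R E (y \<odot>\<^bsub>E\<^esub> x)"
  proof (intro equalityI subsetI)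
    fix a assume "a \<in> P"
    then have a: "a \<in> carrier R" "a \<otimes>\<^bsub>R\<^esub> y = \<zero>\<^bsub>R\<^esub>" using mult_y by auto
    then have "a \<odot>\<^bsub>E\<^esub> (y \<odot>\<^bsub>E\<^esub> x) = \<zero>\<^bsub>E\<^esub>"
      using x y by (simp add: E.smult_assoc1[symmetric])
    then show "a \<in> annihilator R E (y \<odot>\<^bsub>E\<^esub> x)" using a by (simp add: annihilator_def)
  next
    fix a assume "a \<in> annihilator R E (y \<odot>\<^bsub>E\<^esub> x)"
    then have a: "a \<in> carrier R" "a \<odot>\<^bsub>E\<^esub> (y \<odot>\<^bsub>E\<^esub> x) = \<zero>\<^bsub>E\<^esub>"
      by (auto simp: annihilator_def)
    then have "a \<otimes>\<^bsub>R\<^esub> y \<in> annihilator R E x"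
      using x y by (simp add: annihilator_def E.smult_assoc1)
    then show "a \<in> P" using ann P.I_prime a(1) y yP by blast
  qed
  then show "P \<in> Ass R E"
    using P.primeideal_axioms x y by (auto simp: Ass_def)
qed

theorem proposition5p7:
  fixes R :: "('a, 'b) ring_scheme" and M :: "('a, 'm) module"
  assumes "cring R" and "noetherian_ring R" and "local_ring R" and "reduced_ring R"
    and "module R M" and "fin_gen_module R M"
  shows "Ass R (self_module R) \<inter> (\<Union>i::nat. Ass R (Ext R i M (self_module R)))
       = Ass R (self_module R) \<inter> (\<Union>i::nat. Supp R (Ext R i M (self_module R)))"
proof (cases "\<one>\<^bsub>R\<^esub> = \<zero>\<^bsub>R\<^esub>")
  \<comment> \<open>\<open>Ext_module\<close> assumes a nonzero ring. In the zero ring no ideal is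
    prime, so both sides are empty.\<close>
  case True
  interpret cring R by fact
  have "\<not> primeideal P R" for P
  proof
    assume "primeideal P R"
    then interpret P: primeideal P R .
    have "\<one>\<^bsub>R\<^esub> \<in> P" using True P.zero_closed by simp
    then show False using P.one_imp_carrier P.I_notcarr by simp
  qed
  then show ?thesis by (auto simp: Ass_def)
next
  case False
  have "Ass R (self_module R) \<inter> Ass R (Ext R i M (self_module R))
      = Ass R (self_module R) \<inter> Supp R (Ext R i M (self_module R))" for i
  proof -
    have "Module.module R (Ext R i M (self_module R))"
      by (rule Ext_module[OF assms(5) self_module_module[OF assms(1)] False])
    from Ass_subset_Supp[OF this] Ass_self_Int_Supp_subset_Ass[OF assms(4) this]
    show ?thesis by blast
  qed
  \<comment> \<open>Intersection distributes over the unions, so the equality for each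
    \<open>i\<close> suffices.\<close>
  then show ?thesis by (simp only: Int_UN_distrib)
qed

end
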